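(* Let $G$ and $H$ be multiplicative arithmetical functions on the monic polynomials of $A=\mathbb{F}_q[X]$, and for monic $h,f\in A$ put $$S(h;f)=\sum_{g\mid (h,f)} G(g)\,H(f/g).$$ Let $h_1,h_2,f_1,f_2\in A$ be monic polynomials such that $$(h_1,h_2)=(f_1,f_2)=(h_1,f_2)=(h_2,f_1)=1.$$ Then $$S(h_1h_2;f_1f_2)=S(h_1;f_1)\,S(h_2;f_2).$$
   Context: $A=\mathbb{F}_q[X]$ is the polynomial ring over the finite field with $q=p^t$ elements, $p$ prime, $t\ge 1$. An arithmetical function is a complex-valued function on the set of monic polynomials in $A$. An arithmetical function $G$ is multiplicative if $G(1)=1$ and $G(fg)=G(f)G(g)$ for all coprime monic $f,g$. $(a,b)$ denotes the monic greatest common divisor, and sums over $g\mid n$ run over the monic divisors $g$ of $n$. *)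

theory Defs
  imports Complex_Main "HOL-Computational_Algebra.Computational_Algebra"
begin

text \<open>
  The ring \<open>\<bbbF>\<^sub>q[X]\<close> is \<open>'a poly\<close> with \<open>'a :: {finite, field_gcd}\<close>. The class \<open>field_gcd\<close> consists of
  fields together with the normalisation and gcd structure that makes the library's \<open>gcd\<close>
  available on \<open>'a poly\<close>. Every field carries such a structure (see \<open>Field_as_Ring\<close>), so no
  finite field is excluded. Nonzero constants are units, hence have \<open>unit_factor c = c\<close>, so
  \<open>normalize\<close> on \<open>'a poly\<close> divides by the leading coefficient and \<open>gcd\<close> of nonzero polynomials
  is the monic one.

  An arithmetical function is represented by a total function \<open>'a poly \<Rightarrow> complex\<close>; its values
  outside the monic polynomials are arbitrary and never used.
\<close>

abbreviation monic :: "'a :: {zero, one} poly \<Rightarrow> bool" where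
  "monic p \<equiv> lead_coeff p = 1"

definition multiplicative :: "('a :: {finite, field_gcd} poly \<Rightarrow> complex) \<Rightarrow> bool" where
  "multiplicative G \<longleftrightarrow>
     G 1 = 1 \<and> (\<forall>f g. monic f \<longrightarrow> monic g \<longrightarrow> gcd f g = 1 \<longrightarrow> G (f * g) = G f * G g)"

text \<open>
  Here \<open>div\<close> is always exact, since \<open>g dvd gcd h f\<close> entails \<open>g dvd f\<close>. For monic \<open>h\<close> and \<open>f\<close> the
  index set is finite.
\<close>

definition S :: "('a :: {finite, field_gcd} poly \<Rightarrow> complex) \<Rightarrow> ('a poly \<Rightarrow> complex) \<Rightarrow>
    'a poly \<Rightarrow> 'a poly \<Rightarrow> complex" where
  "S G H h f = (\<Sum>g | monic g \<and> g dvd gcd h f. G g * H (f div g))"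

end

theory Submission
  imports Defs
begin

text \<open>
  The index set of \<^term>\<open>S G H (h1 * h2) (f1 * f2)\<close> is the set of monic common divisors of
  \<open>h1 h2\<close> and \<open>f1 f2\<close>. Such a divisor \<open>g\<close> factors as \<open>a b\<close> with \<open>a\<close> dividing \<open>f1\<close> and \<open>b\<close>
  dividing \<open>f2\<close>; since \<open>a\<close> is then coprime to \<open>h2\<close> and \<open>b\<close> to \<open>h1\<close>, the factor \<open>a\<close> must divide
  \<open>h1\<close> and \<open>b\<close> must divide \<open>h2\<close>. Coprimality of \<open>f1\<close> and \<open>f2\<close> makes the factorisation unique
  once both factors are monic, so multiplication is a bijection from the product of the two
  smaller index sets onto the larger one (\<open>bij_betw_times_monic_common_divisors\<close>). Along this
  bijection each summand splits, because \<open>a, b\<close> are coprime and so are the codivisors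
  \<open>f1 / a, f2 / b\<close>; the sum over pairs is then the product of the two sums.
\<close>

text \<open>
  A factorisation of a monic polynomial can be rescaled to monic factors without changing the
  product, as the two leading coefficients are inverse to each other.
\<close>
lemma monic_dvd_mult_decomp:
  fixes g f1 f2 :: "'a :: field_gcd poly"
  assumes "monic g" and "g dvd f1 * f2"
  obtains a b where "monic a" "monic b" "g = a * b" "a dvd f1" "b dvd f2"
proof -
  obtain a b where ab: "g = a * b" "a dvd f1" "b dvd f2"
    using division_decomp[OF assms(2)] by blast
  have lc: "lead_coeff a * lead_coeff b = 1"
    using assms(1) ab(1) by (simp add: lead_coeff_mult)
  then have nz: "lead_coeff a \<noteq> 0" "lead_coeff b \<noteq> 0"
    by (metis mult_zero_left zero_neq_one, metis mult_zero_right zero_neq_one)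
  show thesis
  proof
    show "monic (smult (lead_coeff b) a)" "monic (smult (lead_coeff a) b)"
      using lc nz by (simp_all add: mult.commute)
    show "g = smult (lead_coeff b) a * smult (lead_coeff a) b"
      using lc ab(1) by (simp add: mult.commute)
    show "smult (lead_coeff b) a dvd f1" "smult (lead_coeff a) b dvd f2"
      using ab(2,3) nz by (blast intro: smult_dvd)+
  qed
qed

lemma normalize_of_monic:
  fixes p :: "'a :: field_gcd poly"
  assumes "monic p"
  shows "normalize p = p"
  using assms by (intro poly_eqI) simp

lemma bij_betw_times_monic_common_divisors:
  fixes h1 h2 f1 f2 :: "'a :: field_gcd poly"
  assumes "coprime f1 f2" and "coprime h1 f2" and "coprime h2 f1"
  shows "bij_betw (\<lambda>(a, b). a * b)
           ({a. monic a \<and> a dvd gcd h1 f1} \<times> {b. monic b \<and> b dvd gcd h2 f2})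
           {g. monic g \<and> g dvd gcd (h1 * h2) (f1 * f2)}"
proof (rule bij_betw_imageI)
  show "inj_on (\<lambda>(a, b). a * b)
          ({a. monic a \<and> a dvd gcd h1 f1} \<times> {b. monic b \<and> b dvd gcd h2 f2})"
  proof (rule inj_onI, clarsimp)
    fix a b c d
    assume monic: "monic a" "monic b" "monic c" "monic d"
      and dvd: "a dvd f1" "b dvd f2" "c dvd f1" "d dvd f2"
      and eq: "a * b = c * d"
    have "coprime a d" "coprime c b"
      using dvd assms(1) coprime_divisors by blast+
    moreover have "a dvd c * d" "c dvd a * b"
      using eq by (metis dvd_triv_left)+
    ultimately have "a dvd c" "c dvd a"
      by (simp_all add: coprime_dvd_mult_left_iff)
    then have "a = c"
      using monic normalize_of_monic associated_eqI by blast
    moreover from this have "b = d"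
      using eq monic(3) by auto
    ultimately show "a = c \<and> b = d" ..
  qed
next
  have "g \<in> (\<lambda>(a, b). a * b) `
          ({a. monic a \<and> a dvd gcd h1 f1} \<times> {b. monic b \<and> b dvd gcd h2 f2})"
    if g: "monic g" "g dvd h1 * h2" "g dvd f1 * f2" for g
  proof -
    obtain a b where ab: "monic a" "monic b" "g = a * b" "a dvd f1" "b dvd f2"
      using monic_dvd_mult_decomp g(1,3) by blast
    have "coprime a h2" "coprime b h1"
      using coprime_divisors[OF dvd_refl ab(4) assms(3)] coprime_divisors[OF dvd_refl ab(5) assms(2)]
      by (simp_all add: coprime_commute)
    moreover have "a dvd h1 * h2" "b dvd h1 * h2"
      using g(2) ab(3) dvd_mult_left dvd_mult_right by blast+
    ultimately have "a dvd h1" "b dvd h2"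
      by (simp_all add: coprime_dvd_mult_left_iff coprime_dvd_mult_right_iff)
    with ab show ?thesis
      by force
  qed
  then show "(\<lambda>(a, b). a * b) `
          ({a. monic a \<and> a dvd gcd h1 f1} \<times> {b. monic b \<and> b dvd gcd h2 f2}) =
        {g. monic g \<and> g dvd gcd (h1 * h2) (f1 * f2)}"
    by (auto simp: lead_coeff_mult mult_dvd_mono)
qed

lemma monic_div:
  fixes f g :: "'a :: field_gcd poly"
  assumes "monic f" and "monic g" and "g dvd f"
  shows "monic (f div g)"
  using assms lead_coeff_mult[of g "f div g"] by simp

theorem theorem2p1:
  fixes G H :: "'a :: {finite, field_gcd} poly \<Rightarrow> complex"
    and h1 h2 f1 f2 :: "'a poly"
  assumes "multiplicative G" and "multiplicative H"
    and "monic h1" and "monic h2" and "monic f1" and "monic f2"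
    and "gcd h1 h2 = 1" and "gcd f1 f2 = 1" and "gcd h1 f2 = 1" and "gcd h2 f1 = 1"
  shows "S G H (h1 * h2) (f1 * f2) = S G H h1 f1 * S G H h2 f2"
proof -
  let ?D1 = "{a. monic a \<and> a dvd gcd h1 f1}" and ?D2 = "{b. monic b \<and> b dvd gcd h2 f2}"
  have cop: "coprime f1 f2" "coprime h1 f2" "coprime h2 f1"
    using assms(8-10) by (simp_all add: coprime_iff_gcd_eq_1)
  have G_mult: "G (f * g) = G f * G g" and H_mult: "H (f * g) = H f * H g"
    if "monic f" "monic g" "coprime f g" for f g
    using assms(1,2) that by (simp_all add: multiplicative_def)
  have term_mult: "G (a * b) * H (f1 * f2 div (a * b)) =
      (G a * H (f1 div a)) * (G b * H (f2 div b))"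
    if "a \<in> ?D1" "b \<in> ?D2" for a b
  proof -
    have ab: "monic a" "monic b" "a dvd f1" "b dvd f2"
      using that by auto
    then have "f1 div a dvd f1" "f2 div b dvd f2"
      by (simp_all add: dvdI[of f1 _ a] dvdI[of f2 _ b])
    with ab cop(1) have "coprime a b" "coprime (f1 div a) (f2 div b)"
      using coprime_divisors by blast+
    moreover have "f1 * f2 div (a * b) = (f1 div a) * (f2 div b)"
      using ab(3,4) by (simp add: div_mult_div_if_dvd)
    ultimately show ?thesis
      using ab assms(5,6) by (simp add: G_mult H_mult monic_div)
  qed
  have "S G H (h1 * h2) (f1 * f2) =
      (\<Sum>(a, b)\<in>?D1 \<times> ?D2. G (a * b) * H (f1 * f2 div (a * b)))"
    unfolding S_def
    by (subst sum.reindex_bij_betw[OF bij_betw_times_monic_common_divisors[OF cop], symmetric])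
       (simp add: case_prod_unfold)
  also have "\<dots> = (\<Sum>(a, b)\<in>?D1 \<times> ?D2. (G a * H (f1 div a)) * (G b * H (f2 div b)))"
    by (rule sum.cong) (use term_mult in auto)
  also have "\<dots> = S G H h1 f1 * S G H h2 f2"
    by (simp add: S_def sum_product sum.cartesian_product)
  finally show ?thesis .
qed

end
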